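(* Let $\mathbb K$ be $\mathbb R$ or $\mathbb C$, let $A=A_0\oplus A_1$ be a commutative associative superalgebra over $\mathbb K$ (so $xy=(-1)^{|x||y|}yx$ for homogeneous $x,y$), and let $\delta:A\to A$ be an odd derivation of $A$, i.e. $\delta$ is linear, $|\delta(x)|=|x|+1$ and $\delta(xy)=\delta(x)y+(-1)^{|x|}x\,\delta(y)$ for homogeneous $x,y\in A$. Let $\mathfrak D^\delta=\{x\cdot\delta : x\in A\}$, where $x\cdot\delta$ is the map $y\mapsto x\,\delta(y)$; it is a super vector space with $|x\cdot\delta|=|x|+1$, so $\mathfrak D^\delta_0=\{x\cdot\delta: x\in A_1\}$ and $\mathfrak D^\delta_1=\{x\cdot\delta : x\in A_0\}$, and it is a left $A$-supermodule via $z\cdot(x\cdot\delta)=(zx)\cdot\delta$. Define the bilinear bracket on $\mathfrak D^\delta$ by $$\{X,Y\}=\big(x\,\delta(y)+(-1)^{(|x|+1)(|y|+1)}\,y\,\delta(x)\big)\cdot\delta,\qquad X=x\cdot\delta,\ Y=y\cdot\delta,$$ for homogeneous $x,y$, extended bilinearly. Then: (1) $(\mathfrak D^\delta_0,\{\,,\,\})$ is a Jordan algebra, i.e. the bracket is commutative on $\mathfrak D^\delta_0$ and $\{\{X,X\},\{Y,X\}\}=\{\{\{X,X\},Y\},X\}$ for all $X,Y\in\mathfrak D^\delta_0$. (2) If moreover $\delta^2=0$, then the bracket makes $\mathfrak D^\delta_1$ a Jordan module over $\mathfrak D^\delta_0$: for $X\in\mathfrak D^\delta_0$, $Y\in\mathfrak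 D^\delta_1$ one has $\{X,Y\}=\{Y,X\}$, and $\mathfrak D^\delta_0\oplus\mathfrak D^\delta_1$ with the product $(X_0,X_1).(Y_0,Y_1)=(\{X_0,Y_0\},\{X_0,Y_1\}+\{X_1,Y_0\})$ is a Jordan algebra. (3) For all homogeneous $z\in A$ and homogeneous $X,Y\in\mathfrak D^\delta$, $$2\,z\cdot\{X,Y\}=\{z\cdot X,Y\}+(-1)^{|z||X|}\{X,z\cdot Y\}.$$
   Context: A Jordan algebra is a commutative (not necessarily associative) algebra $(J,\circ)$ satisfying $(x\circ x)\circ(y\circ x)=((x\circ x)\circ y)\circ x$ for all $x,y\in J$. Parities $|\cdot|$ are taken in $\mathbb Z_2$ and all identities are stated for homogeneous elements. *)

theory Defs
  imports Complex_Main
begin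

text \<open>A super vector space structure on the whole carrier type: A = A0 (+) A1,
  where A0, A1 are real subspaces.  (A complex superalgebra is in particular a real
  one, so working over the reals covers both K = R and K = C.)\<close>

definition real_subspace :: "'a::real_vector set \<Rightarrow> bool" where
  "real_subspace S \<longleftrightarrow> 0 \<in> S \<and> (\<forall>x\<in>S. \<forall>y\<in>S. x + y \<in> S) \<and> (\<forall>c. \<forall>x\<in>S. c *\<^sub>R x \<in> S)"

definition homog :: "'a set \<Rightarrow> 'a set \<Rightarrow> 'a \<Rightarrow> bool" where
  "homog A0 A1 x \<longleftrightarrow> x \<in> A0 \<or> x \<in> A1"

text \<open>parity of a homogeneous element (0 is given parity 0; its sign never matters)\<close>
definition par :: "'a set \<Rightarrow> 'a set \<Rightarrow> 'a::zero \<Rightarrow> nat" where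
  "par A0 A1 x = (if x \<in> A0 then 0 else 1)"

definition sgn_par :: "nat \<Rightarrow> 'a::real_vector \<Rightarrow> 'a" where
  "sgn_par n x = ((-1::real) ^ n) *\<^sub>R x"

text \<open>Commutative associative superalgebra structure (associativity comes from the class).\<close>
definition comm_superalgebra :: "'a::real_algebra set \<Rightarrow> 'a set \<Rightarrow> bool" where
  "comm_superalgebra A0 A1 \<longleftrightarrow>
     real_subspace A0 \<and> real_subspace A1 \<and> A0 \<inter> A1 = {0} \<and>
     (\<forall>x. \<exists>a\<in>A0. \<exists>b\<in>A1. x = a + b) \<and>
     (\<forall>x\<in>A0. \<forall>y\<in>A0. x * y \<in> A0) \<and> (\<forall>x\<in>A0. \<forall>y\<in>A1. x * y \<in> A1) \<and>
     (\<forall>x\<in>A1. \<forall>y\<in>A0. x * y \<in> A1) \<and> (\<forall>x\<in>A1. \<forall>y\<in>A1. x * y \<in> A0) \<and>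
     (\<forall>x y. homog A0 A1 x \<longrightarrow> homog A0 A1 y \<longrightarrow>
        x * y = sgn_par (par A0 A1 x * par A0 A1 y) (y * x))"

definition odd_derivation :: "'a::real_algebra set \<Rightarrow> 'a set \<Rightarrow> ('a \<Rightarrow> 'a) \<Rightarrow> bool" where
  "odd_derivation A0 A1 d \<longleftrightarrow>
     (\<forall>x y. d (x + y) = d x + d y) \<and> (\<forall>c x. d (c *\<^sub>R x) = c *\<^sub>R d x) \<and>
     (\<forall>x\<in>A0. d x \<in> A1) \<and> (\<forall>x\<in>A1. d x \<in> A0) \<and>
     (\<forall>x y. homog A0 A1 x \<longrightarrow> homog A0 A1 y \<longrightarrow>
        d (x * y) = d x * y + sgn_par (par A0 A1 x) (x * d y))"

definition dop :: "('a \<Rightarrow> 'a) \<Rightarrow> 'a::real_algebra \<Rightarrow> 'a \<Rightarrow> 'a" where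
  "dop d x = (\<lambda>y. x * d y)"

definition pr0 :: "'a set \<Rightarrow> 'a set \<Rightarrow> 'a::ab_group_add \<Rightarrow> 'a" where
  "pr0 A0 A1 x = (THE a. a \<in> A0 \<and> x - a \<in> A1)"

definition pr1 :: "'a set \<Rightarrow> 'a set \<Rightarrow> 'a::ab_group_add \<Rightarrow> 'a" where
  "pr1 A0 A1 x = x - pr0 A0 A1 x"

text \<open>Bracket on representatives, homogeneous case:
  {x\<cdot>\<delta>, y\<cdot>\<delta>} = (x \<delta>(y) + (-1)^((|x|+1)(|y|+1)) y \<delta>(x))\<cdot>\<delta>;
  this gives the representative of the result.\<close>
definition hbr :: "'a set \<Rightarrow> 'a set \<Rightarrow> ('a \<Rightarrow> 'a) \<Rightarrow> 'a::real_algebra \<Rightarrow> 'a \<Rightarrow> 'a" where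
  "hbr A0 A1 d x y = x * d y + sgn_par ((par A0 A1 x + 1) * (par A0 A1 y + 1)) (y * d x)"

definition br :: "'a set \<Rightarrow> 'a set \<Rightarrow> ('a \<Rightarrow> 'a) \<Rightarrow> 'a::real_algebra \<Rightarrow> 'a \<Rightarrow> 'a" where
  "br A0 A1 d x y =
     hbr A0 A1 d (pr0 A0 A1 x) (pr0 A0 A1 y) + hbr A0 A1 d (pr0 A0 A1 x) (pr1 A0 A1 y) +
     hbr A0 A1 d (pr1 A0 A1 x) (pr0 A0 A1 y) + hbr A0 A1 d (pr1 A0 A1 x) (pr1 A0 A1 y)"

text \<open>Product on D_0 (+) D_1, on pairs of representatives (x0 \<in> A1, x1 \<in> A0):
  (X0,X1).(Y0,Y1) = ({X0,Y0}, {X0,Y1} + {X1,Y0}).\<close>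
definition pprod :: "'a set \<Rightarrow> 'a set \<Rightarrow> ('a \<Rightarrow> 'a) \<Rightarrow> 'a::real_algebra \<times> 'a \<Rightarrow> 'a \<times> 'a \<Rightarrow> 'a \<times> 'a" where
  "pprod A0 A1 d p q = (br A0 A1 d (fst p) (fst q),
                        br A0 A1 d (fst p) (snd q) + br A0 A1 d (snd p) (fst q))"

definition dpair :: "('a \<Rightarrow> 'a) \<Rightarrow> 'a::real_algebra \<times> 'a \<Rightarrow> ('a \<Rightarrow> 'a) \<times> ('a \<Rightarrow> 'a)" where
  "dpair d p = (dop d (fst p), dop d (snd p))"

end

theory Submission
  imports Defs
begin

text \<open>On representatives every bracket with at least one even argument \<open>x \<cdot> \<delta>\<close> (that is, with
  \<open>x\<close> odd) reads \<open>x \<delta>(y) + y \<delta>(x)\<close>, so all identities are identities in \<open>A\<close> itself. Odd elements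
  anticommute and square to zero, which makes the terms containing \<open>\<delta>\<^sup>2(x)\<close> cancel in the
  Jordan identity; with \<open>a = \<delta>(x)\<close> and \<open>b = \<delta>(y)\<close> both of its sides equal \<open>6xa\<^sup>2b + 2ya\<^sup>3\<close>.
  In the module part \<open>\<delta>\<^sup>2 = 0\<close> turns all derivatives into constants of \<open>\<delta>\<close>.\<close>

locale odd_derivation_superalgebra =
  fixes A0 A1 :: "'a::real_algebra set" and d :: "'a \<Rightarrow> 'a"
  assumes superalgebra: "comm_superalgebra A0 A1"
    and derivation: "odd_derivation A0 A1 d"
begin

section \<open>Closure of the grading and linearity of \<open>d\<close>\<close>

lemma subspace_even: "real_subspace A0" and subspace_odd: "real_subspace A1"
  and even_Int_odd: "A0 \<inter> A1 = {0}"
  and even_odd_decomposition: "\<exists>a\<in>A0. \<exists>b\<in>A1. x = a + b"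
  using superalgebra by (auto simp: comm_superalgebra_def)

lemma zero_closed [simp, intro]: "0 \<in> A0" "0 \<in> A1"
  using subspace_even subspace_odd by (auto simp: real_subspace_def)

lemma add_closed [intro]:
  "x \<in> A0 \<Longrightarrow> y \<in> A0 \<Longrightarrow> x + y \<in> A0"
  "x \<in> A1 \<Longrightarrow> y \<in> A1 \<Longrightarrow> x + y \<in> A1"
  using subspace_even subspace_odd by (auto simp: real_subspace_def)

lemma scaleR_closed:
  "x \<in> A0 \<Longrightarrow> c *\<^sub>R x \<in> A0"
  "x \<in> A1 \<Longrightarrow> c *\<^sub>R x \<in> A1"
  using subspace_even subspace_odd by (auto simp: real_subspace_def)

lemma diff_closed:
  "x \<in> A0 \<Longrightarrow> y \<in> A0 \<Longrightarrow> x - y \<in> A0"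
  "x \<in> A1 \<Longrightarrow> y \<in> A1 \<Longrightarrow> x - y \<in> A1"
  using add_closed[of x "(-1) *\<^sub>R y"] scaleR_closed[of y "-1"] by simp_all

lemma mult_closed [intro]:
  "x \<in> A0 \<Longrightarrow> y \<in> A0 \<Longrightarrow> x * y \<in> A0"
  "x \<in> A0 \<Longrightarrow> y \<in> A1 \<Longrightarrow> x * y \<in> A1"
  "x \<in> A1 \<Longrightarrow> y \<in> A0 \<Longrightarrow> x * y \<in> A1"
  "x \<in> A1 \<Longrightarrow> y \<in> A1 \<Longrightarrow> x * y \<in> A0"
  using superalgebra by (auto simp: comm_superalgebra_def)

lemma d_closed [intro]: "x \<in> A0 \<Longrightarrow> d x \<in> A1" "x \<in> A1 \<Longrightarrow> d x \<in> A0"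
  using derivation by (auto simp: odd_derivation_def)

lemmas closed = add_closed diff_closed mult_closed d_closed

lemma d_add [simp]: "d (x + y) = d x + d y"
  and d_scaleR [simp]: "d (c *\<^sub>R x) = c *\<^sub>R d x"
  using derivation by (auto simp: odd_derivation_def)

lemma d_0 [simp]: "d 0 = 0"
  using d_scaleR[of 0 0] by simp

lemma d_diff [simp]: "d (x - y) = d x - d y"
  using d_add[of x "(-1) *\<^sub>R y"] d_scaleR[of "-1" y] by simp

lemma par_even [simp]: "x \<in> A0 \<Longrightarrow> par A0 A1 x = 0"
  by (simp add: par_def)

text \<open>The zero vector has parity 0 even when it is viewed as an odd element.\<close>

lemma par_odd: "x \<in> A1 \<Longrightarrow> x \<noteq> 0 \<Longrightarrow> par A0 A1 x = 1"
  using even_Int_odd by (auto simp: par_def)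

section \<open>Commuting and anticommuting factors\<close>

lemma supercommute:
  "homog A0 A1 x \<Longrightarrow> homog A0 A1 y \<Longrightarrow> x * y = sgn_par (par A0 A1 x * par A0 A1 y) (y * x)"
  using superalgebra unfolding comm_superalgebra_def by blast

text \<open>The sign is trivial against both homogeneous parts of \<open>y\<close>, so an even
  element is central in all of \<open>A\<close>.\<close>

lemma even_commute:
  assumes "x \<in> A0"
  shows "x * y = y * x"
proof -
  have hom: "x * z = z * x" if "homog A0 A1 z" for z
    using supercommute[of x z] assms that by (simp add: homog_def sgn_par_def)
  obtain a b where "a \<in> A0" "b \<in> A1" "y = a + b"
    using even_odd_decomposition by blast
  then show ?thesis
    using hom[of a] hom[of b] by (simp add: homog_def algebra_simps)
qed

lemma even_left_commute: "x \<in> A0 \<Longrightarrow> x * (y * z) = y * (x * z)"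
  by (metis even_commute mult.assoc)

text \<open>Permutative rules, used for ordered rewriting of monomials; both orientations are needed
  because either factor may be the one known to be even.\<close>

lemmas even_sort =
  even_commute even_commute[symmetric] even_left_commute even_left_commute[symmetric]

lemma odd_anticommute:
  assumes "x \<in> A1" "y \<in> A1"
  shows "x * y = - (y * x)"
proof (cases "x = 0 \<or> y = 0")
  case False
  then have "par A0 A1 x = 1" "par A0 A1 y = 1"
    using assms par_odd by auto
  moreover have "x * y = sgn_par (par A0 A1 x * par A0 A1 y) (y * x)"
    using assms by (intro supercommute) (simp_all add: homog_def)
  ultimately show ?thesis
    by (simp add: sgn_par_def)
qed auto

lemma odd_left_anticommute:
  assumes "x \<in> A1" "y \<in> A1"
  shows "x * (y * z) = - (y * (x * z))"
  using odd_anticommute[OF assms] by (metis mult.assoc mult_minus_left)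

text \<open>Anticommuting with itself gives twice the square equal to zero, and 2 is invertible over
  the reals.\<close>

lemma odd_square: "x \<in> A1 \<Longrightarrow> x * x = 0"
  using odd_anticommute[of x x] by (simp add: eq_neg_iff_add_eq_0 flip: scaleR_2)

lemma odd_square_left: "x \<in> A1 \<Longrightarrow> x * (x * z) = 0"
  by (metis odd_square mult.assoc mult_zero_left)

section \<open>Leibniz rules\<close>

lemma leibniz_homog:
  "homog A0 A1 x \<Longrightarrow> homog A0 A1 y \<Longrightarrow> d (x * y) = d x * y + sgn_par (par A0 A1 x) (x * d y)"
  using derivation by (auto simp: odd_derivation_def)

text \<open>The sign depends on the first factor only, so the rule extends additively to second
  factors of mixed parity.\<close>

lemma leibniz_even:
  assumes "x \<in> A0"
  shows "d (x * y) = d x * y + x * d y"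
proof -
  obtain a b where "a \<in> A0" "b \<in> A1" "y = a + b"
    using even_odd_decomposition by blast
  then show ?thesis
    using leibniz_homog[of x a] leibniz_homog[of x b] assms
    by (simp add: homog_def sgn_par_def algebra_simps)
qed

lemma leibniz_odd:
  assumes "x \<in> A1"
  shows "d (x * y) = d x * y - x * d y"
proof (cases "x = 0")
  case False
  obtain a b where "a \<in> A0" "b \<in> A1" "y = a + b"
    using even_odd_decomposition by blast
  then show ?thesis
    using leibniz_homog[of x a] leibniz_homog[of x b] assms par_odd[OF assms False]
    by (simp add: homog_def sgn_par_def algebra_simps)
qed simp

section \<open>Projections and the bracket of homogeneous elements\<close>

lemma pr0_eq:
  assumes "a \<in> A0" "x - a \<in> A1"
  shows "pr0 A0 A1 x = a"
  unfolding pr0_def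
proof (rule the_equality)
  fix a' assume a': "a' \<in> A0 \<and> x - a' \<in> A1"
  \<comment> \<open>Two even parts of \<open>x\<close> differ by an element that is also odd, hence
    by zero.\<close>
  then have "a' - a \<in> A0"
    using assms diff_closed by blast
  moreover have "a' - a \<in> A1"
    using diff_closed(2)[of "x - a" "x - a'"] a' assms by simp
  ultimately have "a' - a = 0"
    using even_Int_odd by blast
  then show "a' = a"
    by simp
qed (use assms in auto)

lemma pr_even [simp]: "x \<in> A0 \<Longrightarrow> pr0 A0 A1 x = x" "x \<in> A0 \<Longrightarrow> pr1 A0 A1 x = 0"
  using pr0_eq[of x x] by (auto simp: pr1_def)

lemma pr_odd [simp]: "x \<in> A1 \<Longrightarrow> pr0 A0 A1 x = 0" "x \<in> A1 \<Longrightarrow> pr1 A0 A1 x = x"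
  using pr0_eq[of 0 x] by (auto simp: pr1_def)

lemma hbr_0 [simp]: "hbr A0 A1 d 0 y = 0" "hbr A0 A1 d x 0 = 0"
  by (auto simp: hbr_def sgn_par_def)

text \<open>One projection of each argument vanishes, so at most one of the four summands
  survives.\<close>

lemma br_eq_hbr:
  assumes "homog A0 A1 x" "homog A0 A1 y"
  shows "br A0 A1 d x y = hbr A0 A1 d x y"
  using assms by (auto simp: homog_def br_def)

lemma br_even_even: "x \<in> A0 \<Longrightarrow> y \<in> A0 \<Longrightarrow> br A0 A1 d x y = x * d y - y * d x"
  by (simp add: br_eq_hbr homog_def hbr_def sgn_par_def)

text \<open>Parity 1 of \<open>x\<close> makes the exponent \<open>(|x|+1)(|y|+1)\<close> even; at
  \<open>x = 0\<close>, where \<open>par\<close> is 0, both sides vanish.\<close>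

lemma br_odd_left:
  assumes "x \<in> A1" "homog A0 A1 y"
  shows "br A0 A1 d x y = x * d y + y * d x"
proof (cases "x = 0")
  case False
  then show ?thesis
    using assms par_odd[of x] by (simp add: br_eq_hbr homog_def hbr_def sgn_par_def)
qed (use assms in \<open>simp add: br_eq_hbr homog_def\<close>)

lemma br_odd_right:
  assumes "homog A0 A1 x" "y \<in> A1"
  shows "br A0 A1 d x y = x * d y + y * d x"
proof (cases "y = 0")
  case False
  then show ?thesis
    using assms par_odd[of y] by (simp add: br_eq_hbr homog_def hbr_def sgn_par_def)
qed (use assms in \<open>simp add: br_eq_hbr homog_def\<close>)

lemma br_commute_odd:
  "x \<in> A1 \<Longrightarrow> homog A0 A1 y \<Longrightarrow> br A0 A1 d x y = br A0 A1 d y x"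
  by (simp add: br_odd_left br_odd_right add.commute)

lemma br_odd_argument:
  "x \<in> A1 \<Longrightarrow> y \<in> A1 \<Longrightarrow> br A0 A1 d x y = x * d y + y * d x"
  "x \<in> A1 \<Longrightarrow> y \<in> A0 \<Longrightarrow> br A0 A1 d x y = x * d y + y * d x"
  "x \<in> A0 \<Longrightarrow> y \<in> A1 \<Longrightarrow> br A0 A1 d x y = x * d y + y * d x"
  by (simp_all add: br_odd_left br_odd_right homog_def)

section \<open>The Jordan identities\<close>

lemma jordan_identity_odd:
  assumes x: "x \<in> A1" and y: "y \<in> A1"
  shows "br A0 A1 d (br A0 A1 d x x) (br A0 A1 d y x) =
    br A0 A1 d (br A0 A1 d (br A0 A1 d x x) y) x"
proof -
  define a b e f where "a = d x" and "b = d y" and "e = d a" and "f = d b"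
  have d: "d x = a" "d y = b" "d a = e" "d b = f"
    by (simp_all add: a_def b_def e_def f_def)
  have even: "a \<in> A0" "b \<in> A0" and odd: "e \<in> A1" "f \<in> A1"
    using x y by (auto simp: a_def b_def e_def f_def)
  \<comment> \<open>Terms in \<open>f\<close> or in the third derivative \<open>d e\<close> contain
    \<open>x\<close> twice and vanish. The anticommutation instances are directed rules that sort
    odd letters as \<open>e\<close>, \<open>x\<close>, \<open>y\<close>, which cancels the terms in
    \<open>e\<close>.\<close>
  note sort = even_sort even odd_square[OF x] odd_square_left[OF x]
    odd_anticommute[OF y x] odd_left_anticommute[OF y x]
    odd_anticommute[OF x odd(1)] odd_left_anticommute[OF x odd(1)]
    odd_anticommute[OF y odd(1)] odd_left_anticommute[OF y odd(1)]
  have xx: "br A0 A1 d x x = x * a + x * a" and yx: "br A0 A1 d y x = y * a + x * b"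
    using x y by (simp_all add: br_odd_argument d)
  show ?thesis
    unfolding xx yx using x y even odd
    by (simp add: br_odd_argument closed leibniz_even leibniz_odd d)
      (simp add: sort algebra_simps)
qed

text \<open>The module axiom in the form of the split null extension; first entries represent the
  even part of the module of derivations, second entries the odd part.\<close>

lemma jordan_identity_pair:
  assumes d2: "\<And>x. d (d x) = 0"
    and x: "x \<in> A1" and u: "u \<in> A0" and y: "y \<in> A1" and v: "v \<in> A0"
  shows "pprod A0 A1 d (pprod A0 A1 d (x, u) (x, u)) (pprod A0 A1 d (y, v) (x, u)) =
    pprod A0 A1 d (pprod A0 A1 d (pprod A0 A1 d (x, u) (x, u)) (y, v)) (x, u)"
proof -
  define a b s t where "a = d x" and "b = d y" and "s = d u" and "t = d v"
  have d: "d x = a" "d y = b" "d u = s" "d v = t" "d a = 0" "d b = 0" "d s = 0" "d t = 0"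
    by (simp_all add: a_def b_def s_def t_def d2)
  have even: "a \<in> A0" "b \<in> A0" and odd: "s \<in> A1" "t \<in> A1"
    using x y u v by (auto simp: a_def b_def s_def t_def)
  have pp: "pprod A0 A1 d (x, u) (x, u) = (x * a + x * a, (x * s + u * a) + (u * a + x * s))"
    and qp: "pprod A0 A1 d (y, v) (x, u) = (y * a + x * b, (y * s + u * b) + (v * a + x * t))"
    using x y u v by (simp_all add: pprod_def br_odd_argument d)
  have closed_products: "x * a \<in> A1" "x * b \<in> A1" "y * a \<in> A1" "x * s \<in> A0" "u * a \<in> A0"
    "y * s \<in> A0" "u * b \<in> A0" "v * a \<in> A0" "x * t \<in> A0"
    using x y u v even odd by auto
  have d_products: "d (x * a) = a * a" "d (x * b) = a * b" "d (y * a) = b * a"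
    "d (x * s) = a * s" "d (u * a) = s * a" "d (y * s) = b * s" "d (u * b) = s * b"
    "d (v * a) = t * a" "d (x * t) = a * t"
    using x y u v by (simp_all add: leibniz_even leibniz_odd d)
  \<comment> \<open>\<open>m\<close> and \<open>n\<close> are the components of the square of
    \<open>(x, u)\<close> times \<open>(y, v)\<close>, named so that each is differentiated only
    once.\<close>
  define m where "m = br A0 A1 d (x * a + x * a) y"
  define n where "n = br A0 A1 d (x * a + x * a) v +
    br A0 A1 d ((x * s + u * a) + (u * a + x * s)) y"
  have m: "m = (x * a + x * a) * b + y * (a * a + a * a)"
    using closed_products y by (simp add: m_def br_odd_argument add_closed d d_products)
  have n: "n = (x * a + x * a) * t + v * (a * a + a * a) +
      (((x * s + u * a) + (u * a + x * s)) * b + y * ((a * s + s * a) + (s * a + a * s)))"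
    using closed_products y v by (simp add: n_def br_odd_argument add_closed d d_products)
  have mn_closed: "m \<in> A1" "n \<in> A0"
    unfolding m n using x y u v even odd closed_products by (auto intro!: add_closed)
  \<comment> \<open>Products of first derivatives are constants of \<open>d\<close>.\<close>
  have d_constants: "d (a * a) = 0" "d (a * s) = 0" "d (s * a) = 0"
    using even odd by (simp_all add: leibniz_even leibniz_odd d)
  have "d m = (a * a + a * a) * b + b * (a * a + a * a)"
    unfolding m using closed_products y
    by (simp add: leibniz_odd add_closed d d_products d_constants)
  moreover have "d n = (a * a + a * a) * t + t * (a * a + a * a) +
      (((a * s + s * a) + (s * a + a * s)) * b + b * ((a * s + s * a) + (s * a + a * s)))"
    unfolding n using closed_products y v
    by (simp add: leibniz_odd leibniz_even add_closed d d_products d_constants)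
  ultimately have "pprod A0 A1 d (m, n) (x, u) =
      (m * a + x * ((a * a + a * a) * b + b * (a * a + a * a)),
       (m * s + u * ((a * a + a * a) * b + b * (a * a + a * a))) +
       (n * a + x * ((a * a + a * a) * t + t * (a * a + a * a) +
      (((a * s + s * a) + (s * a + a * s)) * b + b * ((a * s + s * a) + (s * a + a * s))))))"
    using mn_closed x u by (simp add: pprod_def br_odd_argument d)
  moreover have "pprod A0 A1 d (x * a + x * a, (x * s + u * a) + (u * a + x * s))
      (y * a + x * b, (y * s + u * b) + (v * a + x * t)) =
    ((x * a + x * a) * (b * a + a * b) + (y * a + x * b) * (a * a + a * a),
     ((x * a + x * a) * (b * s + s * b + (t * a + a * t)) +
      (y * s + u * b + (v * a + x * t)) * (a * a + a * a)) +
     ((x * s + u * a + (u * a + x * s)) * (b * a + a * b) +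
      (y * a + x * b) * (a * s + s * a + (s * a + a * s))))"
    using closed_products by (simp add: pprod_def br_odd_argument add_closed d_products)
  moreover have "pprod A0 A1 d (x * a + x * a, (x * s + u * a) + (u * a + x * s)) (y, v) = (m, n)"
    by (simp add: pprod_def m_def n_def)
  \<comment> \<open>The second components both equal 12xabs + 6xa^2t + 6ya^2s + 6ua^2b + 2va^3. The
    odd pairs occur as xs, xt, ys on both sides, so moving the even letters suffices.\<close>
  ultimately show ?thesis
    unfolding pp qp m n
    by (simp add: mult.assoc even_sort even u v distrib_left distrib_right add_ac)
qed

text \<open>On the right the terms containing \<open>d z\<close> cancel by supercommutativity, and
  each other term occurs twice, whence the factor 2.\<close>

lemma br_module_compat:
  assumes "homog A0 A1 z" "homog A0 A1 x" "homog A0 A1 y"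
  shows "2 *\<^sub>R (z * br A0 A1 d x y) = br A0 A1 d (z * x) y +
    sgn_par (par A0 A1 z * (par A0 A1 x + 1)) (br A0 A1 d x (z * y))"
proof (cases "z = 0 \<or> x = 0")
  \<comment> \<open>A zero regarded as odd would enter the sign with parity 0; here both sides
    vanish.\<close>
  case True
  then show ?thesis
    using assms by (auto simp: br_def sgn_par_def)
next
  case False
  then have par: "z \<in> A1 \<Longrightarrow> par A0 A1 z = 1" "x \<in> A1 \<Longrightarrow> par A0 A1 x = 1"
    using par_odd by auto
  note compute = br_odd_argument br_even_even closed leibniz_even leibniz_odd par sgn_par_def
  note sort = d_closed even_sort algebra_simps scaleR_2
  \<comment> \<open>\<open>z\<close> and \<open>d z\<close> have opposite parity: for even
    \<open>z\<close> it is \<open>d z\<close> that must be moved past odd \<open>x\<close> or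
    \<open>y\<close>, for odd \<open>z\<close> it is \<open>z\<close> itself.\<close>
  from assms consider
      "z \<in> A0" "x \<in> A0" "y \<in> A0" | "z \<in> A0" "x \<in> A0" "y \<in> A1"
    | "z \<in> A0" "x \<in> A1" "y \<in> A0" | "z \<in> A0" "x \<in> A1" "y \<in> A1"
    | "z \<in> A1" "x \<in> A0" "y \<in> A0" | "z \<in> A1" "x \<in> A0" "y \<in> A1"
    | "z \<in> A1" "x \<in> A1" "y \<in> A0" | "z \<in> A1" "x \<in> A1" "y \<in> A1"
    unfolding homog_def by blast
  then show ?thesis
  proof cases
    case 1
    then show ?thesis
      by (simp add: compute) (simp add: sort)
  next
    case 2
    then show ?thesis
      by (simp add: compute)
        (simp add: sort odd_anticommute[of "d z" y])
  next
    case 3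
    then show ?thesis
      by (simp add: compute)
        (simp add: sort odd_anticommute[of "d z" x])
  next
    case 4
    then show ?thesis
      by (simp add: compute)
        (simp add: sort
          odd_anticommute[of "d z" x]
          odd_anticommute[of "d z" y]
          odd_left_anticommute[of y x])
  next
    case 5
    then show ?thesis
      by (simp add: compute) (simp add: sort)
  next
    case 6
    then show ?thesis
      by (simp add: compute)
        (simp add: sort odd_left_anticommute[of z y])
  next
    case 7
    then show ?thesis
      by (simp add: compute)
        (simp add: sort odd_left_anticommute[of z x])
  next
    case 8
    then show ?thesis
      by (simp add: compute)
        (simp add: sort
          odd_left_anticommute[of z x]
          odd_left_anticommute[of z y]
          odd_left_anticommute[of y x])
  qed
qed

end

section \<open>From representatives to operators\<close>

theorem theorem5:
  fixes A0 A1 :: "'a::real_algebra set" and d :: "'a \<Rightarrow> 'a"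
  assumes "comm_superalgebra A0 A1" and "odd_derivation A0 A1 d"
  shows
    "((\<forall>x\<in>A1. \<forall>y\<in>A1. dop d (br A0 A1 d x y) = dop d (br A0 A1 d y x)) \<and>
      (\<forall>x\<in>A1. \<forall>y\<in>A1.
        dop d (br A0 A1 d (br A0 A1 d x x) (br A0 A1 d y x)) =
        dop d (br A0 A1 d (br A0 A1 d (br A0 A1 d x x) y) x))) \<and>
     ((\<forall>x. d (d x) = 0) \<longrightarrow>
       (\<forall>x\<in>A1. \<forall>y\<in>A0. dop d (br A0 A1 d x y) = dop d (br A0 A1 d y x)) \<and>
       (\<forall>p\<in>A1 \<times> A0. \<forall>q\<in>A1 \<times> A0.
          dpair d (pprod A0 A1 d p q) = dpair d (pprod A0 A1 d q p)) \<and>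
       (\<forall>p\<in>A1 \<times> A0. \<forall>q\<in>A1 \<times> A0.
          dpair d (pprod A0 A1 d (pprod A0 A1 d p p) (pprod A0 A1 d q p)) =
          dpair d (pprod A0 A1 d (pprod A0 A1 d (pprod A0 A1 d p p) q) p))) \<and>
     (\<forall>z x y. homog A0 A1 z \<longrightarrow> homog A0 A1 x \<longrightarrow> homog A0 A1 y \<longrightarrow>
       (\<forall>w. (2::real) *\<^sub>R (z * br A0 A1 d x y) * d w =
            br A0 A1 d (z * x) y * d w +
            sgn_par (par A0 A1 z * (par A0 A1 x + 1)) (br A0 A1 d x (z * y) * d w)))"
proof -
  interpret odd_derivation_superalgebra A0 A1 d
    using assms by unfold_locales
  have jordan: "pprod A0 A1 d (pprod A0 A1 d p p) (pprod A0 A1 d q p) =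
      pprod A0 A1 d (pprod A0 A1 d (pprod A0 A1 d p p) q) p"
    if "\<forall>x. d (d x) = 0" "p \<in> A1 \<times> A0" "q \<in> A1 \<times> A0" for p q
    using that jordan_identity_pair by (cases p; cases q) auto
  have commute: "pprod A0 A1 d p q = pprod A0 A1 d q p"
    if "p \<in> A1 \<times> A0" "q \<in> A1 \<times> A0" for p q
  proof -
    have "br A0 A1 d (fst p) (fst q) = br A0 A1 d (fst q) (fst p)"
      "br A0 A1 d (fst p) (snd q) = br A0 A1 d (snd q) (fst p)"
      "br A0 A1 d (snd p) (fst q) = br A0 A1 d (fst q) (snd p)"
      using that
        by (auto simp: homog_def mem_Times_iff intro: br_commute_odd br_commute_odd[symmetric])
    then show ?thesis
      by (simp add: pprod_def)
  qed
  have module: "(2::real) *\<^sub>R (z * br A0 A1 d x y) * d w = br A0 A1 d (z * x) y * d w +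
      sgn_par (par A0 A1 z * (par A0 A1 x + 1)) (br A0 A1 d x (z * y) * d w)"
    if "homog A0 A1 z" "homog A0 A1 x" "homog A0 A1 y" for z x y w
    unfolding br_module_compat[OF that] by (simp add: sgn_par_def distrib_right)
  have br_commute: "br A0 A1 d x y = br A0 A1 d y x" if "x \<in> A1" "y \<in> A0 \<or> y \<in> A1" for x y
    using that by (intro br_commute_odd) (auto simp: homog_def)
  \<comment> \<open>The first two parts hold already for representatives, so \<open>arg_cong\<close>
    strips \<open>dop\<close> and \<open>dpair\<close>.\<close>
  show ?thesis
    by (intro conjI impI ballI allI arg_cong[of _ _ "dop d"] arg_cong[of _ _ "dpair d"];
        (rule jordan_identity_odd jordan commute module br_commute)?; blast)
qed

end
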